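(* Let $T\ge 2$ and suppose that the following assumptions hold. (1) (Balanced panel of groups) $N_{g,t}>0$ for all $(g,t)\in\{1,\dots,G\}\times\{1,\dots,T\}$. (2) (Sharp design) $D_{i,g,t}=D_{g,t}$ for all $(g,t)$ and all $i\in\{1,\dots,N_{g,t}\}$. (3) (Independent groups) The vectors $(Y_{g,t}(0),Y_{g,t}(1),D_{g,t})_{1\le t\le T}$, $g=1,\dots,G$, are mutually independent. (4) (Strong exogeneity) For all $g\in\{1,\dots,G\}$ and $t\in\{2,\dots,T\}$, $E(Y_{g,t}(0)-Y_{g,t-1}(0)\mid D_{g,1},\dots,D_{g,T})=E(Y_{g,t}(0)-Y_{g,t-1}(0))$. (5) (Common trends) For every $t\in\{2,\dots,T\}$, $E(Y_{g,t}(0)-Y_{g,t-1}(0))$ does not vary across $g$. Then $$\beta_{fd}=E\left[\sum_{(g,t):D_{g,t}=1}\frac{N_{g,t}}{N_1}\,w_{fd,g,t}\,\Delta_{g,t}\right].$$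
   Context: Setting. There are $G$ groups and $T$ periods; $N_{g,t}$ is the (non-random) number of observations in cell $(g,t)\in\{1,\dots,G\}\times\{1,\dots,T\}$. Observation $i\in\{1,\dots,N_{g,t}\}$ of cell $(g,t)$ has a binary treatment $D_{i,g,t}\in\{0,1\}$, potential outcomes $Y_{i,g,t}(0),Y_{i,g,t}(1)$ and observed outcome $Y_{i,g,t}=Y_{i,g,t}(D_{i,g,t})$. Treatments and potential outcomes are random variables, and potential outcomes have finite expectations. Cell averages: $D_{g,t}=\frac1{N_{g,t}}\sum_i D_{i,g,t}$, $Y_{g,t}(d)=\frac1{N_{g,t}}\sum_i Y_{i,g,t}(d)$ for $d\in\{0,1\}$, $Y_{g,t}=\frac1{N_{g,t}}\sum_i Y_{i,g,t}$. The average treatment effect in cell $(g,t)$ is $\Delta_{g,t}=\frac1{N_{g,t}}\sum_{i=1}^{N_{g,t}}[Y_{i,g,t}(1)-Y_{i,g,t}(0)]$. $N_1=\sum_{i,g,t}D_{i,g,t}$ is the number of treated observations. Regression. $\widehat\beta_{fd}$ is the coefficient of $D_{g,t}-D_{g,t-1}$ in the OLS regression of $Y_{g,t}-Y_{g,t-1}$ on period fixed effects and $D_{g,t}-D_{g,t-1}$, among observations with $t\ge2$ (so each cell $(g,t)$, $t\ge 2$, is weighted by its number of observations $N_{g,t}$). $\beta_{fd}=E[\widehat\beta_{fd}]$. Standing assumption: (almost surely) $D_{g,t}-D_{g,t-1}$ is not collinear with the period fixed effects, so that $\widehat\beta_{fd}$ is well defined. Weights. For $t\in\{2,\dots,T\}$,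 $\varepsilon_{fd,g,t}$ is the residual of cell $(g,t)$ in the regression of $D_{g,t}-D_{g,t-1}$ on period fixed effects, among observations with $t\ge2$ (cells weighted by $N_{g,t}$). Set $\varepsilon_{fd,g,1}=\varepsilon_{fd,g,T+1}=0$ for all $g$ (and for $t=T$ the term $\frac{N_{g,T+1}}{N_{g,T}}\varepsilon_{fd,g,T+1}$ is $0$). Then $$w_{fd,g,t}=\frac{\varepsilon_{fd,g,t}-\frac{N_{g,t+1}}{N_{g,t}}\varepsilon_{fd,g,t+1}}{\sum_{(g',t'):D_{g',t'}=1}\frac{N_{g',t'}}{N_1}\left(\varepsilon_{fd,g',t'}-\frac{N_{g',t'+1}}{N_{g',t'}}\varepsilon_{fd,g',t'+1}\right)},$$ the denominator being nonzero under the non-collinearity assumption. *)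

theory Defs
  imports "HOL-Probability.Probability"
begin

text \<open>
  Groups are \<open>1..G\<close>, periods \<open>1..T\<close>, and \<open>N g t\<close> is the number of observations of cell \<open>(g, t)\<close>.
  \<open>D i g t\<close> and \<open>Y d i g t\<close> are the treatment and the potential outcome under treatment \<open>d\<close> of
  observation \<open>i\<close> of that cell, as functions on the probability space. A function of type
  \<open>nat \<Rightarrow> nat \<Rightarrow> _\<close> whose arguments are called \<open>g t\<close> is an array indexed by cells.
\<close>

section \<open>Cell-level variables\<close>

definition cell_avg ::
  "(nat \<Rightarrow> nat \<Rightarrow> nat) \<Rightarrow> (nat \<Rightarrow> nat \<Rightarrow> nat \<Rightarrow> 'a \<Rightarrow> real) \<Rightarrow> nat \<Rightarrow> nat \<Rightarrow> 'a \<Rightarrow> real" where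
  "cell_avg N Z g t \<omega> = (\<Sum>i\<in>{1..N g t}. Z i g t \<omega>) / real (N g t)"

definition treat_avg ::
  "(nat \<Rightarrow> nat \<Rightarrow> nat) \<Rightarrow> (nat \<Rightarrow> nat \<Rightarrow> nat \<Rightarrow> 'a \<Rightarrow> nat) \<Rightarrow> nat \<Rightarrow> nat \<Rightarrow> 'a \<Rightarrow> real" where
  "treat_avg N D = cell_avg N (\<lambda>i g t \<omega>. real (D i g t \<omega>))"

definition pot_avg ::
  "(nat \<Rightarrow> nat \<Rightarrow> nat) \<Rightarrow> (nat \<Rightarrow> nat \<Rightarrow> nat \<Rightarrow> nat \<Rightarrow> 'a \<Rightarrow> real) \<Rightarrow> nat \<Rightarrow> nat \<Rightarrow> nat \<Rightarrow> 'a \<Rightarrow> real" where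
  "pot_avg N Y d = cell_avg N (Y d)"

definition outcome_avg ::
  "(nat \<Rightarrow> nat \<Rightarrow> nat) \<Rightarrow> (nat \<Rightarrow> nat \<Rightarrow> nat \<Rightarrow> 'a \<Rightarrow> nat) \<Rightarrow>
   (nat \<Rightarrow> nat \<Rightarrow> nat \<Rightarrow> nat \<Rightarrow> 'a \<Rightarrow> real) \<Rightarrow> nat \<Rightarrow> nat \<Rightarrow> 'a \<Rightarrow> real" where
  "outcome_avg N D Y = cell_avg N (\<lambda>i g t \<omega>. Y (D i g t \<omega>) i g t \<omega>)"

definition effect_avg ::
  "(nat \<Rightarrow> nat \<Rightarrow> nat) \<Rightarrow> (nat \<Rightarrow> nat \<Rightarrow> nat \<Rightarrow> nat \<Rightarrow> 'a \<Rightarrow> real) \<Rightarrow> nat \<Rightarrow> nat \<Rightarrow> 'a \<Rightarrow> real" where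
  "effect_avg N Y = cell_avg N (\<lambda>i g t \<omega>. Y 1 i g t \<omega> - Y 0 i g t \<omega>)"

definition num_treated ::
  "nat \<Rightarrow> nat \<Rightarrow> (nat \<Rightarrow> nat \<Rightarrow> nat) \<Rightarrow> (nat \<Rightarrow> nat \<Rightarrow> nat \<Rightarrow> 'a \<Rightarrow> nat) \<Rightarrow> 'a \<Rightarrow> nat" where
  "num_treated G T N D \<omega> = (\<Sum>g\<in>{1..G}. \<Sum>t\<in>{1..T}. \<Sum>i\<in>{1..N g t}. D i g t \<omega>)"

definition treated_cells ::
  "nat \<Rightarrow> nat \<Rightarrow> (nat \<Rightarrow> nat \<Rightarrow> nat) \<Rightarrow> (nat \<Rightarrow> nat \<Rightarrow> nat \<Rightarrow> 'a \<Rightarrow> nat) \<Rightarrow> 'a \<Rightarrow> (nat \<times> nat) set" where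
  "treated_cells G T N D \<omega> = {(g, t). g \<in> {1..G} \<and> t \<in> {1..T} \<and> treat_avg N D g t \<omega> = 1}"

text \<open>Only used for periods \<open>t \<ge> 2\<close>.\<close>

definition first_diff :: "(nat \<Rightarrow> nat \<Rightarrow> 'a \<Rightarrow> real) \<Rightarrow> nat \<Rightarrow> nat \<Rightarrow> 'a \<Rightarrow> real" where
  "first_diff Z g t \<omega> = Z g t \<omega> - Z g (t - 1) \<omega>"

section \<open>Regressions with period fixed effects, among observations with \<open>t \<ge> 2\<close>\<close>

text \<open>
  Sum of squared residuals of the array \<open>u\<close> after subtracting the period effects \<open>\<gamma>\<close>. All
  observations of a cell share the same values, hence the cell weights \<open>N g t\<close>. The values
  of \<open>\<gamma>\<close> outside \<open>{2..T}\<close> play no role.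
\<close>

definition fe_ssr ::
  "nat \<Rightarrow> nat \<Rightarrow> (nat \<Rightarrow> nat \<Rightarrow> nat) \<Rightarrow> (nat \<Rightarrow> nat \<Rightarrow> real) \<Rightarrow> (nat \<Rightarrow> real) \<Rightarrow> real" where
  "fe_ssr G T N u \<gamma> = (\<Sum>g\<in>{1..G}. \<Sum>t\<in>{2..T}. real (N g t) * (u g t - \<gamma> t)\<^sup>2)"

definition fe_collinear :: "nat \<Rightarrow> nat \<Rightarrow> (nat \<Rightarrow> nat \<Rightarrow> real) \<Rightarrow> bool" where
  "fe_collinear G T x \<longleftrightarrow> (\<exists>\<gamma> :: nat \<Rightarrow> real. \<forall>g\<in>{1..G}. \<forall>t\<in>{2..T}. x g t = \<gamma> t)"

text \<open>
  The OLS coefficient of \<open>x\<close> in the regression of \<open>y\<close> on period fixed effects and \<open>x\<close>. If \<open>x\<close> is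
  collinear with the fixed effects the minimiser is not unique and the coefficient is set to 0;
  an arbitrary choice there could make the estimator non-measurable on a null event.
\<close>

definition fe_ols_coef ::
  "nat \<Rightarrow> nat \<Rightarrow> (nat \<Rightarrow> nat \<Rightarrow> nat) \<Rightarrow> (nat \<Rightarrow> nat \<Rightarrow> real) \<Rightarrow> (nat \<Rightarrow> nat \<Rightarrow> real) \<Rightarrow> real" where
  "fe_ols_coef G T N y x =
    (if fe_collinear G T x then 0
     else snd (arg_min (\<lambda>(\<gamma>, b). fe_ssr G T N (\<lambda>g t. y g t - b * x g t) \<gamma>) (\<lambda>_. True)))"

text \<open>
  Residual of cell \<open>(g, t)\<close> in the regression of \<open>x\<close> on period fixed effects, extended by 0 to
  \<open>t = 1\<close> and \<open>t = T + 1\<close>.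
\<close>

definition fe_resid ::
  "nat \<Rightarrow> nat \<Rightarrow> (nat \<Rightarrow> nat \<Rightarrow> nat) \<Rightarrow> (nat \<Rightarrow> nat \<Rightarrow> real) \<Rightarrow> nat \<Rightarrow> nat \<Rightarrow> real" where
  "fe_resid G T N x g t =
    (if t \<in> {2..T} then x g t - arg_min (fe_ssr G T N x) (\<lambda>_. True) t else 0)"

section \<open>First-difference estimator and weights\<close>

definition beta_fd_hat ::
  "nat \<Rightarrow> nat \<Rightarrow> (nat \<Rightarrow> nat \<Rightarrow> nat) \<Rightarrow> (nat \<Rightarrow> nat \<Rightarrow> nat \<Rightarrow> 'a \<Rightarrow> nat) \<Rightarrow>
   (nat \<Rightarrow> nat \<Rightarrow> nat \<Rightarrow> nat \<Rightarrow> 'a \<Rightarrow> real) \<Rightarrow> 'a \<Rightarrow> real" where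
  "beta_fd_hat G T N D Y \<omega> =
    fe_ols_coef G T N (\<lambda>g t. first_diff (outcome_avg N D Y) g t \<omega>)
      (\<lambda>g t. first_diff (treat_avg N D) g t \<omega>)"

definition beta_fd ::
  "'a measure \<Rightarrow> nat \<Rightarrow> nat \<Rightarrow> (nat \<Rightarrow> nat \<Rightarrow> nat) \<Rightarrow> (nat \<Rightarrow> nat \<Rightarrow> nat \<Rightarrow> 'a \<Rightarrow> nat) \<Rightarrow>
   (nat \<Rightarrow> nat \<Rightarrow> nat \<Rightarrow> nat \<Rightarrow> 'a \<Rightarrow> real) \<Rightarrow> real" where
  "beta_fd M G T N D Y = (\<integral>\<omega>. beta_fd_hat G T N D Y \<omega> \<partial>M)"

definition eps_fd ::
  "nat \<Rightarrow> nat \<Rightarrow> (nat \<Rightarrow> nat \<Rightarrow> nat) \<Rightarrow> (nat \<Rightarrow> nat \<Rightarrow> nat \<Rightarrow> 'a \<Rightarrow> nat) \<Rightarrow>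
   nat \<Rightarrow> nat \<Rightarrow> 'a \<Rightarrow> real" where
  "eps_fd G T N D g t \<omega> = fe_resid G T N (\<lambda>g t. first_diff (treat_avg N D) g t \<omega>) g t"

text \<open>
  The numerator of the weights. For \<open>t = T\<close> the second term vanishes because \<open>eps_fd\<close> is 0 at
  \<open>T + 1\<close>, whatever the value of \<open>N g (T + 1)\<close>.
\<close>

definition w_num_fd ::
  "nat \<Rightarrow> nat \<Rightarrow> (nat \<Rightarrow> nat \<Rightarrow> nat) \<Rightarrow> (nat \<Rightarrow> nat \<Rightarrow> nat \<Rightarrow> 'a \<Rightarrow> nat) \<Rightarrow>
   nat \<Rightarrow> nat \<Rightarrow> 'a \<Rightarrow> real" where
  "w_num_fd G T N D g t \<omega> =
    eps_fd G T N D g t \<omega> - real (N g (t + 1)) / real (N g t) * eps_fd G T N D g (t + 1) \<omega>"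

definition w_fd ::
  "nat \<Rightarrow> nat \<Rightarrow> (nat \<Rightarrow> nat \<Rightarrow> nat) \<Rightarrow> (nat \<Rightarrow> nat \<Rightarrow> nat \<Rightarrow> 'a \<Rightarrow> nat) \<Rightarrow>
   nat \<Rightarrow> nat \<Rightarrow> 'a \<Rightarrow> real" where
  "w_fd G T N D g t \<omega> =
    w_num_fd G T N D g t \<omega> /
    (\<Sum>(g', t')\<in>treated_cells G T N D \<omega>.
       real (N g' t') / real (num_treated G T N D \<omega>) * w_num_fd G T N D g' t' \<omega>)"

definition weighted_effects_fd ::
  "nat \<Rightarrow> nat \<Rightarrow> (nat \<Rightarrow> nat \<Rightarrow> nat) \<Rightarrow> (nat \<Rightarrow> nat \<Rightarrow> nat \<Rightarrow> 'a \<Rightarrow> nat) \<Rightarrow>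
   (nat \<Rightarrow> nat \<Rightarrow> nat \<Rightarrow> nat \<Rightarrow> 'a \<Rightarrow> real) \<Rightarrow> 'a \<Rightarrow> real" where
  "weighted_effects_fd G T N D Y \<omega> =
    (\<Sum>(g, t)\<in>treated_cells G T N D \<omega>.
       real (N g t) / real (num_treated G T N D \<omega>) * w_fd G T N D g t \<omega> * effect_avg N Y g t \<omega>)"

section \<open>Group-level random vectors\<close>

definition group_vector ::
  "nat \<Rightarrow> (nat \<Rightarrow> nat \<Rightarrow> nat) \<Rightarrow> (nat \<Rightarrow> nat \<Rightarrow> nat \<Rightarrow> 'a \<Rightarrow> nat) \<Rightarrow>
   (nat \<Rightarrow> nat \<Rightarrow> nat \<Rightarrow> nat \<Rightarrow> 'a \<Rightarrow> real) \<Rightarrow> nat \<Rightarrow> 'a \<Rightarrow> nat \<Rightarrow> real \<times> real \<times> real" where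
  "group_vector T N D Y g \<omega> =
    (\<lambda>t\<in>{1..T}. (pot_avg N Y 0 g t \<omega>, pot_avg N Y 1 g t \<omega>, treat_avg N D g t \<omega>))"

text \<open>The sigma-algebra generated by the treatments of group \<open>g\<close> in all periods.\<close>

definition treat_algebra ::
  "'a measure \<Rightarrow> nat \<Rightarrow> (nat \<Rightarrow> nat \<Rightarrow> nat) \<Rightarrow> (nat \<Rightarrow> nat \<Rightarrow> nat \<Rightarrow> 'a \<Rightarrow> nat) \<Rightarrow> nat \<Rightarrow> 'a measure" where
  "treat_algebra M T N D g =
    vimage_algebra (space M) (\<lambda>\<omega>. \<lambda>t\<in>{1..T}. treat_avg N D g t \<omega>) (Pi\<^sub>M {1..T} (\<lambda>_. borel))"

end

theory Submission
  imports Defs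
begin

text \<open>
  By the Frisch-Waugh-Lovell theorem the estimator is a weighted sum of the outcome trends with
  weights \<open>fd_coef\<close> that depend on the treatments only and sum to 0 over the groups in each period.
  In a sharp design the outcome is \<open>Y(0) + D \<cdot> \<Delta>\<close>; summation by parts over the periods turns the
  contribution of \<open>D \<cdot> \<Delta>\<close> into the weighted sum of treatment effects, and the same identity with
  \<open>\<Delta> = 1\<close> identifies its normalisation. What remains is the weighted sum of the trends of \<open>Y(0)\<close>.
  The treatments take finitely many values, so a weight is a linear combination of indicators of
  treatment patterns. Under such an indicator, independence across groups and strong exogeneity
  allow each trend to be replaced by its mean. By common trends this mean is the same for all
  groups, and the weights sum to 0.
\<close>

section \<open>Least squares with period fixed effects\<close>

definition period_mean :: "nat \<Rightarrow> (nat \<Rightarrow> nat \<Rightarrow> nat) \<Rightarrow> (nat \<Rightarrow> nat \<Rightarrow> real) \<Rightarrow> nat \<Rightarrow> real" where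
  "period_mean G N u t = (\<Sum>g\<in>{1..G}. real (N g t) * u g t) / (\<Sum>g\<in>{1..G}. real (N g t))"

text \<open>Closed form of the residual on period fixed effects; \<open>fe_resid_eq_within\<close>
  links it to the \<open>arg_min\<close> version.\<close>

definition fe_within :: "nat \<Rightarrow> (nat \<Rightarrow> nat \<Rightarrow> nat) \<Rightarrow> (nat \<Rightarrow> nat \<Rightarrow> real) \<Rightarrow> nat \<Rightarrow> nat \<Rightarrow> real" where
  "fe_within G N u g t = u g t - period_mean G N u t"

definition within_ss :: "nat \<Rightarrow> nat \<Rightarrow> (nat \<Rightarrow> nat \<Rightarrow> nat) \<Rightarrow> (nat \<Rightarrow> nat \<Rightarrow> real) \<Rightarrow> real" where
  "within_ss G T N u = (\<Sum>g\<in>{1..G}. \<Sum>t\<in>{2..T}. real (N g t) * (fe_within G N u g t)\<^sup>2)"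

text \<open>Exchanging the sums lets the period effect leave each group sum: a zero weighted sum in
  every period is orthogonality to all period effects.\<close>

lemma sum_mult_period_const:
  fixes N :: "nat \<Rightarrow> nat \<Rightarrow> nat" and r :: "nat \<Rightarrow> nat \<Rightarrow> real"
  assumes "\<And>t. t \<in> {2..T} \<Longrightarrow> (\<Sum>g\<in>{1..G}. real (N g t) * r g t) = 0"
  shows "(\<Sum>g\<in>{1..G}. \<Sum>t\<in>{2..T}. real (N g t) * r g t * c t) = 0"
proof -
  have "(\<Sum>t\<in>{2..T}. (\<Sum>g\<in>{1..G}. real (N g t) * r g t) * c t) = 0"
    using assms by (intro sum.neutral) simp
  then show ?thesis
    by (subst sum.swap) (simp add: sum_distrib_right)
qed

lemma fe_ssr_nonneg: "0 \<le> fe_ssr G T N u \<gamma>"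
  unfolding fe_ssr_def by (intro sum_nonneg) simp

text \<open>Pythagoras: both cross terms vanish. The first summand is free of
  \<open>\<gamma>\<close>, so only the fit of \<open>v\<close> is left to minimise.\<close>

lemma fe_ssr_orthogonal:
  assumes "\<And>t. t \<in> {2..T} \<Longrightarrow> (\<Sum>g\<in>{1..G}. real (N g t) * r g t) = 0"
    and "(\<Sum>g\<in>{1..G}. \<Sum>t\<in>{2..T}. real (N g t) * r g t * v g t) = 0"
  shows "fe_ssr G T N (\<lambda>g t. r g t + v g t) \<gamma>
       = fe_ssr G T N r (\<lambda>_. 0) + fe_ssr G T N v \<gamma>"
proof -
  have "real (N g t) * (r g t + v g t - \<gamma> t)\<^sup>2 =
      real (N g t) * (r g t - 0)\<^sup>2 + real (N g t) * (v g t - \<gamma> t)\<^sup>2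
      + (2 * (real (N g t) * r g t * v g t) - 2 * (real (N g t) * r g t * \<gamma> t))" for g t
    by (simp add: power2_eq_square algebra_simps)
  then have "fe_ssr G T N (\<lambda>g t. r g t + v g t) \<gamma>
       = fe_ssr G T N r (\<lambda>_. 0) + fe_ssr G T N v \<gamma>
       + (2 * (\<Sum>g\<in>{1..G}. \<Sum>t\<in>{2..T}. real (N g t) * r g t * v g t)
          - 2 * (\<Sum>g\<in>{1..G}. \<Sum>t\<in>{2..T}. real (N g t) * r g t * \<gamma> t))"
    by (simp only: fe_ssr_def sum.distrib sum_subtractf sum_distrib_left)
  then show ?thesis
    using assms(2) sum_mult_period_const[where c = \<gamma>, OF assms(1)] by simp
qed

text \<open>Strictly positive weights make the weighted sum of squares definite: a zero sum forces
  every residual to vanish.\<close>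

locale positive_cells =
  fixes G T :: nat and N :: "nat \<Rightarrow> nat \<Rightarrow> nat"
  assumes pos: "\<And>g t. g \<in> {1..G} \<Longrightarrow> t \<in> {2..T} \<Longrightarrow> 0 < N g t"
begin

lemma sum_within_eq_0:
  assumes "t \<in> {2..T}"
  shows "(\<Sum>g\<in>{1..G}. real (N g t) * fe_within G N u g t) = 0"
\<comment> \<open>Without groups the mean is 0 / 0, but the group sum is empty; otherwise the total
  weight is positive and cancels.\<close>
proof (cases "G = 0")
  case False
  then have "(\<Sum>g\<in>{1..G}. real (N g t)) > 0"
    using pos[OF _ assms] by (intro sum_pos) auto
  then show ?thesis
    by (simp only: fe_within_def right_diff_distrib sum_subtractf flip: sum_distrib_right)
      (simp add: period_mean_def)
qed simp

lemma sum_within_period_const: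
  "(\<Sum>g\<in>{1..G}. \<Sum>t\<in>{2..T}. real (N g t) * fe_within G N u g t * c t) = 0"
  by (rule sum_mult_period_const) (rule sum_within_eq_0)

text \<open>The two sides differ by a pairing with the period means of \<open>v\<close>, to which
  demeaned arrays are orthogonal.\<close>

lemma sum_within_mult_within:
  "(\<Sum>g\<in>{1..G}. \<Sum>t\<in>{2..T}. real (N g t) * fe_within G N u g t * fe_within G N v g t)
       = (\<Sum>g\<in>{1..G}. \<Sum>t\<in>{2..T}. real (N g t) * fe_within G N u g t * v g t)"
  using sum_within_period_const[where u = u and c = "period_mean G N v"]
  by (simp add: fe_within_def[of G N v] right_diff_distrib sum_subtractf)

lemma within_ss_altdef:
  "within_ss G T N u = (\<Sum>g\<in>{1..G}. \<Sum>t\<in>{2..T}. real (N g t) * fe_within G N u g t * u g t)"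
  using sum_within_mult_within[where u = u and v = u]
  by (simp add: within_ss_def power2_eq_square mult.assoc)

lemma weighted_ss_eq_0_D:
  assumes "(\<Sum>g\<in>{1..G}. \<Sum>t\<in>{2..T}. real (N g t) * (r g t)\<^sup>2) = 0"
    and "g \<in> {1..G}" "t \<in> {2..T}"
  shows "r g t = 0"
proof -
  have "(\<Sum>t\<in>{2..T}. real (N g t) * (r g t)\<^sup>2) = 0"
    using assms(1,2) sum_nonneg_eq_0_iff[of "{1..G}" "\<lambda>g. \<Sum>t\<in>{2..T}. real (N g t) * (r g t)\<^sup>2"]
    by (simp add: sum_nonneg del: One_nat_def)
  then have "real (N g t) * (r g t)\<^sup>2 = 0"
    using assms(3) sum_nonneg_eq_0_iff[of "{2..T}" "\<lambda>t. real (N g t) * (r g t)\<^sup>2"]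
    by simp
  then show ?thesis
    using pos[OF assms(2,3)] by simp
qed

text \<open>A period-constant array pairs to 0 with its own demeaned version; conversely, a zero sum
  of squares leaves \<open>x\<close> equal to its period means.\<close>

lemma fe_collinear_iff:
  "fe_collinear G T x \<longleftrightarrow> within_ss G T N x = 0"
proof
  assume "fe_collinear G T x"
  then obtain \<gamma> where \<gamma>: "x g t = \<gamma> t" if "g \<in> {1..G}" "t \<in> {2..T}" for g t
    unfolding fe_collinear_def by blast
  have "within_ss G T N x = (\<Sum>g\<in>{1..G}. \<Sum>t\<in>{2..T}. real (N g t) * fe_within G N x g t * \<gamma> t)"
    unfolding within_ss_altdef by (intro sum.cong refl) (simp only: \<gamma>)
  then show "within_ss G T N x = 0"
    by (simp only: sum_within_period_const)
next
  assume "within_ss G T N x = 0"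
  then have "fe_within G N x g t = 0" if "g \<in> {1..G}" "t \<in> {2..T}" for g t
    using weighted_ss_eq_0_D[where r = "fe_within G N x"] that
    unfolding within_ss_def by blast
  then show "fe_collinear G T x"
    unfolding fe_collinear_def fe_within_def by (intro exI[of _ "period_mean G N x"]) auto
qed

lemma fe_ssr_eq_0_D:
  assumes "fe_ssr G T N u \<gamma> = 0"
    and "g \<in> {1..G}" "t \<in> {2..T}"
  shows "u g t = \<gamma> t"
  using weighted_ss_eq_0_D[where r = "\<lambda>g t. u g t - \<gamma> t"] assms
  unfolding fe_ssr_def by simp

text \<open>\<open>arg_min\<close> is known only through the minimal value it attains. By Pythagoras
  the excess over that value is the weighted squared distance from the period means, so, as there is
  a group, every minimiser equals them on \<open>{2..T}\<close>.\<close>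

lemma fe_resid_eq_within:
  assumes g: "g \<in> {1..G}" and t: "t \<in> {2..T}"
  shows "fe_resid G T N x g t = fe_within G N x g t"
proof -
  let ?m = "period_mean G N x"
  let ?s = "fe_ssr G T N (fe_within G N x) (\<lambda>_. 0)"
  let ?\<gamma> = "arg_min (fe_ssr G T N x) (\<lambda>_. True)"
  have split: "fe_ssr G T N x \<gamma> = ?s + fe_ssr G T N (\<lambda>g t. ?m t) \<gamma>" for \<gamma>
    using fe_ssr_orthogonal[where r = "fe_within G N x" and v = "\<lambda>g t. ?m t" and \<gamma> = \<gamma>,
        OF sum_within_eq_0 sum_within_period_const]
    by (simp add: fe_within_def)
  have "fe_ssr G T N (\<lambda>g t. ?m t) ?m = 0"
    by (simp add: fe_ssr_def)
  then have "fe_ssr G T N x ?\<gamma> = fe_ssr G T N x ?m"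
    using fe_ssr_nonneg
    by (intro arg_min_equality[where f = "fe_ssr G T N x"]) (simp_all add: split)
  then have "fe_ssr G T N (\<lambda>g t. ?m t) ?\<gamma> = 0"
    using \<open>fe_ssr G T N (\<lambda>g t. ?m t) ?m = 0\<close> by (simp add: split)
  from fe_ssr_eq_0_D[OF this g t] have "?m t = ?\<gamma> t" by simp
  then show ?thesis
    using t by (simp add: fe_resid_def fe_within_def)
qed

text \<open>In the collinear case the right-hand side is 0 as well, because of \<open>x / 0 = 0\<close>.\<close>

lemma fe_ols_coef_eq:
  "fe_ols_coef G T N y x =
    (\<Sum>g\<in>{1..G}. \<Sum>t\<in>{2..T}. real (N g t) * fe_within G N x g t * y g t) / within_ss G T N x"
proof (cases "fe_collinear G T x")
  case True
  then show ?thesis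
    using fe_collinear_iff[where x = x] by (simp add: fe_ols_coef_def)
next
  case False
  then have ss: "within_ss G T N x \<noteq> 0"
    using fe_collinear_iff[where x = x] by simp
  \<comment> \<open>\<open>r\<close> is the residual at the candidate slope \<open>\<beta>\<close>
    with period effects \<open>\<delta>\<close>; \<open>v b\<close> is what the slope
    \<open>b\<close> adds to \<open>r\<close> before any period effects are subtracted.\<close>
  define \<beta> where "\<beta> =
    (\<Sum>g\<in>{1..G}. \<Sum>t\<in>{2..T}. real (N g t) * fe_within G N x g t * y g t) / within_ss G T N x"
  define r where "r g t = fe_within G N y g t - \<beta> * fe_within G N x g t" for g t
  define \<delta> where "\<delta> t = period_mean G N y t - \<beta> * period_mean G N x t" for t
  define v where "v b g t = \<delta> t + (\<beta> - b) * x g t" for b g t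
  define F where "F = (\<lambda>(\<gamma>, b). fe_ssr G T N (\<lambda>g t. y g t - b * x g t) \<gamma>)"
  have r_fe: "(\<Sum>g\<in>{1..G}. real (N g t) * r g t) = 0" if "t \<in> {2..T}" for t
  proof -
    have "(\<Sum>g\<in>{1..G}. real (N g t) * r g t) =
        (\<Sum>g\<in>{1..G}. real (N g t) * fe_within G N y g t)
        - \<beta> * (\<Sum>g\<in>{1..G}. real (N g t) * fe_within G N x g t)"
      by (simp add: r_def right_diff_distrib sum_subtractf sum_distrib_left mult_ac)
    then show ?thesis
      by (simp only: sum_within_eq_0[OF that] mult_zero_right diff_self)
  qed
  \<comment> \<open>The normal equation that determines \<open>\<beta>\<close>; symmetry of the
    demeaned pairing produces its numerator.\<close>
  have r_x: "(\<Sum>g\<in>{1..G}. \<Sum>t\<in>{2..T}. real (N g t) * r g t * x g t) = 0"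
  proof -
    have "(\<Sum>g\<in>{1..G}. \<Sum>t\<in>{2..T}. real (N g t) * r g t * x g t)
       = (\<Sum>g\<in>{1..G}. \<Sum>t\<in>{2..T}. real (N g t) * fe_within G N y g t * x g t)
         - \<beta> * (\<Sum>g\<in>{1..G}. \<Sum>t\<in>{2..T}. real (N g t) * fe_within G N x g t * x g t)"
      by (simp add: r_def algebra_simps sum_subtractf sum_distrib_left)
    also have "(\<Sum>g\<in>{1..G}. \<Sum>t\<in>{2..T}. real (N g t) * fe_within G N y g t * x g t)
       = (\<Sum>g\<in>{1..G}. \<Sum>t\<in>{2..T}. real (N g t) * fe_within G N x g t * y g t)"
      using sum_within_mult_within[where u = x and v = y]
        sum_within_mult_within[where u = y and v = x]
      by (simp add: mult_ac)
    finally show ?thesis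
      using ss by (simp only: \<beta>_def flip: within_ss_altdef) simp
  qed
  have "(\<Sum>g\<in>{1..G}. \<Sum>t\<in>{2..T}. real (N g t) * r g t * v b g t)
      = (\<Sum>g\<in>{1..G}. \<Sum>t\<in>{2..T}. real (N g t) * r g t * \<delta> t)
        + (\<beta> - b) * (\<Sum>g\<in>{1..G}. \<Sum>t\<in>{2..T}. real (N g t) * r g t * x g t)" for b
    unfolding v_def by (simp add: distrib_left sum.distrib sum_distrib_left mult_ac)
  then have r_v: "(\<Sum>g\<in>{1..G}. \<Sum>t\<in>{2..T}. real (N g t) * r g t * v b g t) = 0" for b
    by (simp only: r_x sum_mult_period_const[OF r_fe] mult_zero_right add_0)
  have "y g t - b * x g t = r g t + v b g t" for b g t
    by (simp add: r_def v_def \<delta>_def fe_within_def algebra_simps)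
  then have F: "F (\<gamma>, b) = fe_ssr G T N r (\<lambda>_. 0) + fe_ssr G T N (v b) \<gamma>" for \<gamma> b
    using fe_ssr_orthogonal[OF r_fe r_v[of b], where \<gamma> = \<gamma>] by (simp add: F_def)
  have opt: "fe_ssr G T N (v \<beta>) \<delta> = 0"
    by (simp add: fe_ssr_def v_def)
  obtain \<gamma> b where \<gamma>b: "arg_min F (\<lambda>_. True) = (\<gamma>, b)"
    by force
  \<comment> \<open>In the split of \<open>F\<close> the second summand is 0 at
    \<open>(\<delta>, \<beta>)\<close>, hence at every minimiser.\<close>
  have "F (arg_min F (\<lambda>_. True)) = F (\<delta>, \<beta>)"
    using fe_ssr_nonneg by (intro arg_min_equality) (auto simp: F opt)
  then have "fe_ssr G T N (v b) \<gamma> = 0"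
    by (simp add: \<gamma>b F opt)
  from fe_ssr_eq_0_D[OF this]
  have v_eq: "(\<beta> - b) * x g t = \<gamma> t - \<delta> t" if "g \<in> {1..G}" "t \<in> {2..T}" for g t
    using that by (fastforce simp: v_def)
  \<comment> \<open>A different slope would express \<open>x\<close> through period effects
    alone.\<close>
  have "b = \<beta>"
  proof (rule ccontr)
    assume "b \<noteq> \<beta>"
    then have "x g t = (\<gamma> t - \<delta> t) / (\<beta> - b)" if "g \<in> {1..G}" "t \<in> {2..T}" for g t
      using v_eq[OF that] by (simp add: field_simps)
    then have "fe_collinear G T x"
      unfolding fe_collinear_def by (intro exI[of _ "\<lambda>t. (\<gamma> t - \<delta> t) / (\<beta> - b)"]) blast
    with False show False ..
  qed
  then show ?thesis
    using False \<gamma>b by (simp add: fe_ols_coef_def F_def \<beta>_def)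
qed

end

section \<open>Summation by parts, trend weights and auxiliary facts\<close>

lemma summation_by_parts:
  fixes a z :: "nat \<Rightarrow> real"
  assumes "1 \<le> T"
  shows "(\<Sum>t\<in>{2..T}. a t * (z t - z (t - 1)))
       = (\<Sum>t\<in>{1..T}. (a t - a (t + 1)) * z t) - a 1 * z 1 + a (T + 1) * z T"
  using assms
\<comment> \<open>The boundary terms stay explicit so that the induction closes; they vanish for
  weights that are 0 at \<open>1\<close> and \<open>T + 1\<close>.\<close>
proof (induction T rule: dec_induct)
  case base
  then show ?case by (simp add: algebra_simps)
next
  case (step n)
  then show ?case by (simp add: algebra_simps)
qed

lemma later_period: "t \<in> {2..T} \<Longrightarrow> t \<in> {1..T}" for t T :: nat
  by auto

lemma previous_period: "t \<in> {2..T} \<Longrightarrow> t - 1 \<in> {1..T}" for t T :: nat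
  by auto

text \<open>The Frisch-Waugh-Lovell weight of an outcome trend. It takes a treatment array, not a
  sample point, so that it can be evaluated at a fixed treatment pattern.\<close>

definition fd_coef ::
  "nat \<Rightarrow> nat \<Rightarrow> (nat \<Rightarrow> nat \<Rightarrow> nat) \<Rightarrow> (nat \<Rightarrow> nat \<Rightarrow> real) \<Rightarrow> nat \<Rightarrow> nat \<Rightarrow> real" where
  "fd_coef G T N d g t =
    real (N g t) * fe_within G N (\<lambda>g t. d g t - d g (t - 1)) g t
      / within_ss G T N (\<lambda>g t. d g t - d g (t - 1))"

text \<open>Only panel cells enter, because \<open>t - 1\<close> stays in \<open>{1..T}\<close>.
  This serves patterns that are restricted to the panel.\<close>

lemma fd_coef_cong:
  assumes "\<And>g t. g \<in> {1..G} \<Longrightarrow> t \<in> {1..T} \<Longrightarrow> d g t = d' g t"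
    and g: "g \<in> {1..G}" and t: "t \<in> {2..T}"
  shows "fd_coef G T N d g t = fd_coef G T N d' g t"
proof -
  have diff: "d g t - d g (t - 1) = d' g t - d' g (t - 1)" if "g \<in> {1..G}" "t \<in> {2..T}" for g t
    using that by (simp only: assms(1)[OF _ later_period] assms(1)[OF _ previous_period])
  have "period_mean G N (\<lambda>g t. d g t - d g (t - 1)) t
      = period_mean G N (\<lambda>g t. d' g t - d' g (t - 1)) t" if "t \<in> {2..T}" for t
    unfolding period_mean_def using diff that by simp
  then have "fe_within G N (\<lambda>g t. d g t - d g (t - 1)) g t
      = fe_within G N (\<lambda>g t. d' g t - d' g (t - 1)) g t" if "g \<in> {1..G}" "t \<in> {2..T}" for g t
    unfolding fe_within_def using diff that by simp
  then show ?thesis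
    using g t by (simp add: fd_coef_def within_ss_def del: One_nat_def)
qed

text \<open>A simple function is bounded, so a multiple of \<open>f\<close> dominates the product.
  Finite first moments of the outcomes thus suffice for treatment-dependent weights.\<close>

lemma integrable_simple_function_mult:
  fixes c f :: "'a \<Rightarrow> real"
  assumes c: "simple_function M c" and f: "integrable M f"
  shows "integrable M (\<lambda>\<omega>. c \<omega> * f \<omega>)"
proof -
  have "finite ((\<lambda>\<omega>. \<bar>c \<omega>\<bar>) ` space M)"
    using simple_functionD(1)[OF simple_function_compose1[OF c, of abs]] .
  then have "bdd_above ((\<lambda>\<omega>. \<bar>c \<omega>\<bar>) ` space M)"
    by (rule bdd_above_finite)
  then obtain B where B: "\<forall>\<omega>\<in>space M. \<bar>c \<omega>\<bar> \<le> B"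
    unfolding bdd_above_def by (auto simp only: ball_simps)
  have "integrable M (\<lambda>\<omega>. B * f \<omega>)"
    using f by simp
  moreover have "(\<lambda>\<omega>. c \<omega> * f \<omega>) \<in> borel_measurable M"
    using borel_measurable_simple_function[OF c] f by simp
  moreover have "AE \<omega> in M. norm (c \<omega> * f \<omega>) \<le> norm (B * f \<omega>)"
  proof (rule AE_I2)
    fix \<omega> assume "\<omega> \<in> space M"
    then have "\<bar>c \<omega>\<bar> \<le> \<bar>B\<bar>"
      using B by force
    then show "norm (c \<omega> * f \<omega>) \<le> norm (B * f \<omega>)"
      by (simp add: abs_mult mult_right_mono)
  qed
  ultimately show ?thesis
    by (rule Bochner_Integration.integrable_bound)
qed

lemma cell_avg_integrable:
  assumes "\<And>i. i \<in> {1..N g t} \<Longrightarrow> integrable M (Z i g t)"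
  shows "integrable M (cell_avg N Z g t)"
  unfolding cell_avg_def using assms by (intro integrable_divide Bochner_Integration.integrable_sum) auto

text \<open>The index set is random; indicators move the randomness into the summands, where
  measurability and integrability rules apply.\<close>

lemma sum_treated_cells:
  fixes f :: "nat \<Rightarrow> nat \<Rightarrow> real"
  shows "(\<Sum>(g, t)\<in>treated_cells G T N D \<omega>. f g t)
    = (\<Sum>g\<in>{1..G}. \<Sum>t\<in>{1..T}. of_bool (treat_avg N D g t \<omega> = 1) * f g t)"
proof -
  have "treated_cells G T N D \<omega> = {(g, t) \<in> {1..G} \<times> {1..T}. treat_avg N D g t \<omega> = 1}"
    by (auto simp: treated_cells_def)
  then have "(\<Sum>(g, t)\<in>treated_cells G T N D \<omega>. f g t)
      = (\<Sum>(g, t)\<in>{1..G} \<times> {1..T}. of_bool (treat_avg N D g t \<omega> = 1) * f g t)"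
    by (intro sum.mono_neutral_cong_left) auto
  then show ?thesis
    by (simp only: sum.cartesian_product)
qed

section \<open>Simple weights, integrability and the pathwise decomposition\<close>

locale fd_panel = prob_space M for M :: "'a measure" +
  fixes G T :: nat
    and N :: "nat \<Rightarrow> nat \<Rightarrow> nat"
    and D :: "nat \<Rightarrow> nat \<Rightarrow> nat \<Rightarrow> 'a \<Rightarrow> nat"
    and Y :: "nat \<Rightarrow> nat \<Rightarrow> nat \<Rightarrow> nat \<Rightarrow> 'a \<Rightarrow> real"
  assumes T: "2 \<le> T"
    and binary_treatment: "\<And>g t i. g \<in> {1..G} \<Longrightarrow> t \<in> {1..T} \<Longrightarrow> i \<in> {1..N g t} \<Longrightarrow>
          D i g t \<in> measurable M (count_space {0, 1})"
    and potential_outcomes: "\<And>d g t i. d \<in> {0, 1} \<Longrightarrow> g \<in> {1..G} \<Longrightarrow> t \<in> {1..T} \<Longrightarrow>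
          i \<in> {1..N g t} \<Longrightarrow> integrable M (Y d i g t)"
    and balanced_panel: "\<And>g t. g \<in> {1..G} \<Longrightarrow> t \<in> {1..T} \<Longrightarrow> 0 < N g t"
begin

sublocale positive_cells G T N
  by unfold_locales (rule balanced_panel[OF _ later_period])

abbreviation "treat \<omega> g t \<equiv> treat_avg N D g t \<omega>"
abbreviation "dtreat \<omega> g t \<equiv> first_diff (treat_avg N D) g t \<omega>"
abbreviation "coef \<omega> g t \<equiv> fd_coef G T N (treat \<omega>) g t"

lemma treatment_binary:
  assumes "g \<in> {1..G}" "t \<in> {1..T}" "i \<in> {1..N g t}" "\<omega> \<in> space M"
  shows "D i g t \<omega> \<in> {0, 1}"
  using measurable_space[OF binary_treatment[OF assms(1-3)] assms(4)] by (simp only: space_count_space)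

text \<open>Everything computed arithmetically from the treatments inherits simplicity, hence is
  measurable and bounded.\<close>

lemma D_simple:
  assumes "g \<in> {1..G}" "t \<in> {1..T}" "i \<in> {1..N g t}"
  shows "simple_function M (D i g t)"
proof -
  have "finite (D i g t ` space M)"
  proof (rule finite_subset)
    show "D i g t ` space M \<subseteq> {0, 1}"
      by (rule image_subsetI) (rule treatment_binary[OF assms])
  qed simp
  moreover have "D i g t \<in> measurable M (count_space UNIV)"
    by (rule measurable_compose[OF binary_treatment[OF assms]]) (rule measurable_count_space)
  ultimately show ?thesis
    by (simp add: simple_function_eq_measurable)
qed

lemma treat_simple:
  assumes "g \<in> {1..G}" "t \<in> {1..T}"
  shows "simple_function M (\<lambda>\<omega>. treat \<omega> g t)"
  unfolding treat_avg_def cell_avg_def using assms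
  by (intro simple_function_div simple_function_sum simple_function_real_of_nat D_simple
      simple_function_const)

lemma first_diff_treat_simple:
  assumes "g \<in> {1..G}" "t \<in> {2..T}"
  shows "simple_function M (\<lambda>\<omega>. dtreat \<omega> g t)"
  unfolding first_diff_def using assms
  by (intro simple_function_diff treat_simple later_period[OF assms(2)] previous_period[OF assms(2)])

lemma within_simple:
  assumes "g \<in> {1..G}" "t \<in> {2..T}"
  shows "simple_function M (\<lambda>\<omega>. fe_within G N (dtreat \<omega>) g t)"
  unfolding fe_within_def period_mean_def using assms
  by (intro simple_function_diff simple_function_div simple_function_sum simple_function_mult
      simple_function_const first_diff_treat_simple)

lemma within_ss_simple: "simple_function M (\<lambda>\<omega>. within_ss G T N (dtreat \<omega>))"
  unfolding within_ss_def power2_eq_square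
  by (intro simple_function_sum simple_function_mult simple_function_const within_simple)

lemma coef_eq:
  "coef \<omega> g t = real (N g t) * fe_within G N (dtreat \<omega>) g t / within_ss G T N (dtreat \<omega>)"
  by (simp add: fd_coef_def first_diff_def)

lemma coef_simple:
  assumes "g \<in> {1..G}" "t \<in> {2..T}"
  shows "simple_function M (\<lambda>\<omega>. coef \<omega> g t)"
  unfolding coef_eq using assms
  by (intro simple_function_div simple_function_mult simple_function_const within_simple
      within_ss_simple)

text \<open>Replaces the choice made by \<open>arg_min\<close> by an explicit formula in the
  treatments, which gives simplicity of the weights.\<close>

lemma eps_fd_eq:
  assumes "g \<in> {1..G}"
  shows "eps_fd G T N D g t \<omega> = (if t \<in> {2..T} then fe_within G N (dtreat \<omega>) g t else 0)"
proof (cases "t \<in> {2..T}")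
  case True
  then show ?thesis
    by (simp only: eps_fd_def fe_resid_eq_within[OF assms True] if_True)
next
  case False
  then show ?thesis
    by (simp only: eps_fd_def fe_resid_def if_False)
qed

lemma w_num_fd_simple:
  assumes g: "g \<in> {1..G}"
  shows "simple_function M (\<lambda>\<omega>. w_num_fd G T N D g t \<omega>)"
proof -
  have "simple_function M (\<lambda>\<omega>. eps_fd G T N D g t \<omega>)" for t
  proof (cases "t \<in> {2..T}")
    case True
    then show ?thesis
      by (simp only: eps_fd_eq[OF g] if_True within_simple[OF g True])
  next
    case False
    then show ?thesis
      by (simp only: eps_fd_eq[OF g] if_False simple_function_const)
  qed
  then show ?thesis
    unfolding w_num_fd_def by (intro simple_function_diff simple_function_mult simple_function_const)
qed

lemma num_treated_simple: "simple_function M (\<lambda>\<omega>. real (num_treated G T N D \<omega>))"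
  unfolding num_treated_def
  by (intro simple_function_real_of_nat simple_function_sum D_simple)

lemma treated_simple:
  assumes "g \<in> {1..G}" "t \<in> {1..T}"
  shows "simple_function M (\<lambda>\<omega>. of_bool (treat \<omega> g t = 1) :: real)"
  by (rule simple_function_compose1[OF treat_simple[OF assms]])

lemma w_fd_simple:
  assumes "g \<in> {1..G}"
  shows "simple_function M (\<lambda>\<omega>. w_fd G T N D g t \<omega>)"
  unfolding w_fd_def sum_treated_cells using assms
  by (intro simple_function_div simple_function_sum simple_function_mult simple_function_const
      w_num_fd_simple num_treated_simple treated_simple)

lemma pot_avg_integrable:
  assumes "k \<in> {0, 1}" "g \<in> {1..G}" "t \<in> {1..T}"
  shows "integrable M (pot_avg N Y k g t)"
  unfolding pot_avg_def using potential_outcomes assms by (intro cell_avg_integrable) auto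

lemma effect_avg_integrable:
  assumes "g \<in> {1..G}" "t \<in> {1..T}"
  shows "integrable M (effect_avg N Y g t)"
  unfolding effect_avg_def using potential_outcomes assms
  by (intro cell_avg_integrable Bochner_Integration.integrable_diff) auto

lemma outcome_avg_integrable:
  assumes "g \<in> {1..G}" "t \<in> {1..T}"
  shows "integrable M (outcome_avg N D Y g t)"
  unfolding outcome_avg_def
proof (rule cell_avg_integrable)
  fix i assume i: "i \<in> {1..N g t}"
  \<comment> \<open>The random index of \<open>Y\<close> is resolved by splitting over the two
    treatment values into simple functions times integrable ones.\<close>
  have "Y (D i g t \<omega>) i g t \<omega>
      = of_bool (D i g t \<omega> = 1) * Y 1 i g t \<omega> + of_bool (D i g t \<omega> = 0) * Y 0 i g t \<omega>"
    if "\<omega> \<in> space M" for \<omega>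
    using treatment_binary[OF assms i that] by auto
  moreover have "integrable M (\<lambda>\<omega>. of_bool (D i g t \<omega> = 1) * Y 1 i g t \<omega>
      + of_bool (D i g t \<omega> = 0) * Y 0 i g t \<omega>)"
    using potential_outcomes assms i
    by (intro Bochner_Integration.integrable_add integrable_simple_function_mult
        simple_function_compose1[OF D_simple]) auto
  ultimately show "integrable M (\<lambda>\<omega>. Y (D i g t \<omega>) i g t \<omega>)"
    by (simp cong: Bochner_Integration.integrable_cong)
qed

lemma first_diff_integrable:
  assumes "\<And>g t. g \<in> {1..G} \<Longrightarrow> t \<in> {1..T} \<Longrightarrow> integrable M (Z g t)"
    and "g \<in> {1..G}" "t \<in> {2..T}"
  shows "integrable M (first_diff Z g t)"
  unfolding first_diff_def using assms
  by (intro Bochner_Integration.integrable_diff assms(1) later_period[OF assms(3)] previous_period[OF assms(3)])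

text \<open>Valid at every sample point, with both sides 0 under collinearity, so the estimator
  inherits integrability from the explicit sum.\<close>

lemma beta_fd_hat_eq:
  "beta_fd_hat G T N D Y \<omega>
    = (\<Sum>g\<in>{1..G}. \<Sum>t\<in>{2..T}. coef \<omega> g t * first_diff (outcome_avg N D Y) g t \<omega>)"
  unfolding beta_fd_hat_def fe_ols_coef_eq coef_eq by (simp add: sum_divide_distrib)

lemma weighted_effects_fd_eq:
  "weighted_effects_fd G T N D Y \<omega>
    = (\<Sum>g\<in>{1..G}. \<Sum>t\<in>{1..T}. of_bool (treat \<omega> g t = 1) *
        (real (N g t) / real (num_treated G T N D \<omega>) * w_fd G T N D g t \<omega> * effect_avg N Y g t \<omega>))"
  unfolding weighted_effects_fd_def by (rule sum_treated_cells)

lemma beta_fd_hat_integrable: "integrable M (beta_fd_hat G T N D Y)"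
  unfolding beta_fd_hat_eq[abs_def]
  by (intro Bochner_Integration.integrable_sum integrable_simple_function_mult coef_simple
      first_diff_integrable outcome_avg_integrable)

lemma weighted_effects_fd_integrable: "integrable M (weighted_effects_fd G T N D Y)"
  unfolding weighted_effects_fd_eq[abs_def] mult.assoc[symmetric]
  by (intro Bochner_Integration.integrable_sum integrable_simple_function_mult
      simple_function_mult simple_function_div simple_function_const treated_simple
      num_treated_simple w_fd_simple effect_avg_integrable)

text \<open>Inherited from demeaning within the period; it is what cancels a trend common to all
  groups.\<close>

lemma sum_coef_eq_0:
  assumes "t \<in> {2..T}"
  shows "(\<Sum>g\<in>{1..G}. coef \<omega> g t) = 0"
proof -
  have "(\<Sum>g\<in>{1..G}. coef \<omega> g t)
      = (\<Sum>g\<in>{1..G}. real (N g t) * fe_within G N (dtreat \<omega>) g t) / within_ss G T N (dtreat \<omega>)"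
    by (simp only: coef_eq sum_divide_distrib)
  then show ?thesis
    by (simp only: sum_within_eq_0[OF assms] div_0)
qed

text \<open>Summation by parts moves the difference from \<open>z\<close> to the weighted residuals;
  factoring out \<open>N g t\<close> creates the ratio of cell sizes in
  \<open>w_num_fd\<close>.\<close>

lemma sum_within_first_diff:
  assumes g: "g \<in> {1..G}"
  shows "(\<Sum>t\<in>{2..T}. real (N g t) * fe_within G N (dtreat \<omega>) g t * (z t - z (t - 1)))
    = (\<Sum>t\<in>{1..T}. real (N g t) * w_num_fd G T N D g t \<omega> * z t)"
proof -
  let ?a = "\<lambda>t. real (N g t) * eps_fd G T N D g t \<omega>"
  have "(\<Sum>t\<in>{2..T}. real (N g t) * fe_within G N (dtreat \<omega>) g t * (z t - z (t - 1)))
      = (\<Sum>t\<in>{2..T}. ?a t * (z t - z (t - 1)))"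
    by (intro sum.cong refl) (simp only: eps_fd_eq[OF g] if_True)
  \<comment> \<open>Both boundary terms vanish, since the residual is extended by 0 to
    \<open>1\<close> and \<open>T + 1\<close>.\<close>
  also have "\<dots> = (\<Sum>t\<in>{1..T}. (?a t - ?a (t + 1)) * z t)"
    using summation_by_parts[of T ?a z] T by (simp add: eps_fd_eq[OF g])
  also have "\<dots> = (\<Sum>t\<in>{1..T}. real (N g t) * w_num_fd G T N D g t \<omega> * z t)"
    using balanced_panel[OF g]
    by (intro sum.cong refl) (simp add: w_num_fd_def right_diff_distrib)
  finally show ?thesis .
qed

text \<open>Pure algebra at one sample point: the observed trend is the untreated trend plus the
  change of treatment times effect, and \<open>sum_within_first_diff\<close> converts the latter
  into weighted effects.\<close>

lemma beta_fd_hat_decomp: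
  assumes nc: "\<not> fe_collinear G T (dtreat \<omega>)"
    and D01: "\<And>g t i. g \<in> {1..G} \<Longrightarrow> t \<in> {1..T} \<Longrightarrow> i \<in> {1..N g t} \<Longrightarrow> D i g t \<omega> \<in> {0, 1}"
    and sharp: "\<And>g t i. g \<in> {1..G} \<Longrightarrow> t \<in> {1..T} \<Longrightarrow> i \<in> {1..N g t} \<Longrightarrow>
          real (D i g t \<omega>) = treat \<omega> g t"
  shows "beta_fd_hat G T N D Y \<omega> = weighted_effects_fd G T N D Y \<omega>
    + (\<Sum>g\<in>{1..G}. \<Sum>t\<in>{2..T}. coef \<omega> g t * first_diff (pot_avg N Y 0) g t \<omega>)"
proof -
  define S where "S = within_ss G T N (dtreat \<omega>)"
  define N1 where "N1 = real (num_treated G T N D \<omega>)"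
  let ?w = "\<lambda>g t. w_num_fd G T N D g t \<omega>" and ?\<Delta> = "\<lambda>g t. effect_avg N Y g t \<omega>"
  have S: "S \<noteq> 0"
    using nc by (simp add: S_def fe_collinear_iff)
  \<comment> \<open>Every cell has a first observation, whose binary treatment is the cell
    average.\<close>
  have d01: "treat \<omega> g t \<in> {0, 1}" if "g \<in> {1..G}" "t \<in> {1..T}" for g t
    using D01[OF that, of 1] sharp[OF that, of 1] balanced_panel[OF that] by auto
  have of_bool_d: "of_bool (treat \<omega> g t = 1) = treat \<omega> g t" if "g \<in> {1..G}" "t \<in> {1..T}" for g t
    using d01[OF that] by auto
  \<comment> \<open>If no observation were treated, all treatment changes would be 0, hence
    collinear with the period effects.\<close>
  have N1: "N1 \<noteq> 0"
  proof
    assume "N1 = 0"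
    then have "num_treated G T N D \<omega> = 0"
      by (simp only: N1_def of_nat_eq_0_iff)
    then have "D i g t \<omega> = 0" if "g \<in> {1..G}" "t \<in> {1..T}" "i \<in> {1..N g t}" for g t i
      using that by (simp only: num_treated_def sum_eq_0_iff finite_atLeastAtMost)
    then have d0: "treat \<omega> g t = 0" if "g \<in> {1..G}" "t \<in> {1..T}" for g t
      using that by (simp add: treat_avg_def cell_avg_def)
    have "dtreat \<omega> g t = 0" if "g \<in> {1..G}" "t \<in> {2..T}" for g t
      using that by (simp only: first_diff_def d0[OF _ later_period] d0[OF _ previous_period] diff_self)
    then have "fe_collinear G T (dtreat \<omega>)"
      unfolding fe_collinear_def by (intro exI[of _ "\<lambda>_. 0"]) blast
    with nc show False ..
  qed
  have outcome: "outcome_avg N D Y g t \<omega> = pot_avg N Y 0 g t \<omega> + treat \<omega> g t * ?\<Delta> g t"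
    if gt: "g \<in> {1..G}" "t \<in> {1..T}" for g t
  proof -
    have "D i g t \<omega> = (if treat \<omega> g t = 1 then 1 else 0)" if "i \<in> {1..N g t}" for i
      using sharp[OF gt that] D01[OF gt that] by auto
    then have "outcome_avg N D Y g t \<omega> = pot_avg N Y (if treat \<omega> g t = 1 then 1 else 0) g t \<omega>"
      by (simp add: outcome_avg_def pot_avg_def cell_avg_def)
    then show ?thesis
      using d01[OF gt]
      by (auto simp: pot_avg_def effect_avg_def cell_avg_def sum_subtractf diff_divide_distrib)
  qed
  \<comment> \<open>Taking the treatment itself as \<open>z\<close> amounts to a unit effect in all
    cells; this identifies the normalisation of the weights with the regression denominator.\<close>
  have S_eq: "S = (\<Sum>g\<in>{1..G}. \<Sum>t\<in>{1..T}. real (N g t) * ?w g t * treat \<omega> g t)"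
    unfolding S_def within_ss_altdef
  proof (rule sum.cong[OF refl])
    fix g assume "g \<in> {1..G}"
    from sum_within_first_diff[OF this, of \<omega> "treat \<omega> g"]
    show "(\<Sum>t\<in>{2..T}. real (N g t) * fe_within G N (dtreat \<omega>) g t * dtreat \<omega> g t)
      = (\<Sum>t\<in>{1..T}. real (N g t) * ?w g t * treat \<omega> g t)"
      by (simp only: first_diff_def)
  qed
  have denom: "(\<Sum>(g', t')\<in>treated_cells G T N D \<omega>. real (N g' t') / N1 * ?w g' t') = S / N1"
    unfolding sum_treated_cells S_eq sum_divide_distrib
    by (intro sum.cong refl) (simp add: of_bool_d)
  \<comment> \<open>\<open>N1\<close> occurs both in the outer weight and in the normalisation, and
    cancels.\<close>
  have weighted: "weighted_effects_fd G T N D Y \<omega>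
      = (\<Sum>g\<in>{1..G}. \<Sum>t\<in>{1..T}. real (N g t) * ?w g t * (treat \<omega> g t * ?\<Delta> g t)) / S"
    unfolding weighted_effects_fd_eq w_fd_def denom[unfolded N1_def] sum_divide_distrib
    unfolding N1_def[symmetric]
    using N1 by (intro sum.cong refl) (simp add: of_bool_d)
  have fd: "first_diff (outcome_avg N D Y) g t \<omega> = first_diff (pot_avg N Y 0) g t \<omega>
      + (treat \<omega> g t * ?\<Delta> g t - treat \<omega> g (t - 1) * ?\<Delta> g (t - 1))" if "g \<in> {1..G}" "t \<in> {2..T}" for g t
    using that outcome[OF _ later_period] outcome[OF _ previous_period] by (simp add: first_diff_def del: One_nat_def)
  have "beta_fd_hat G T N D Y \<omega>
      = (\<Sum>g\<in>{1..G}. \<Sum>t\<in>{2..T}. coef \<omega> g t * first_diff (pot_avg N Y 0) g t \<omega>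
        + real (N g t) * fe_within G N (dtreat \<omega>) g t
          * (treat \<omega> g t * ?\<Delta> g t - treat \<omega> g (t - 1) * ?\<Delta> g (t - 1)) / S)"
    unfolding beta_fd_hat_eq
    by (intro sum.cong refl) (simp add: fd distrib_left coef_eq S_def)
  also have "\<dots> = (\<Sum>g\<in>{1..G}. \<Sum>t\<in>{2..T}. coef \<omega> g t * first_diff (pot_avg N Y 0) g t \<omega>)
      + (\<Sum>g\<in>{1..G}. \<Sum>t\<in>{2..T}. real (N g t) * fe_within G N (dtreat \<omega>) g t
          * (treat \<omega> g t * ?\<Delta> g t - treat \<omega> g (t - 1) * ?\<Delta> g (t - 1))) / S"
    by (simp only: sum.distrib sum_divide_distrib)
  also have "(\<Sum>g\<in>{1..G}. \<Sum>t\<in>{2..T}. real (N g t) * fe_within G N (dtreat \<omega>) g t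
          * (treat \<omega> g t * ?\<Delta> g t - treat \<omega> g (t - 1) * ?\<Delta> g (t - 1)))
      = (\<Sum>g\<in>{1..G}. \<Sum>t\<in>{1..T}. real (N g t) * ?w g t * (treat \<omega> g t * ?\<Delta> g t))"
    by (rule sum.cong[OF refl]) (rule sum_within_first_diff)
  finally show ?thesis
    by (simp add: weighted)
qed

end

section \<open>Weighted untreated trends have expectation 0\<close>

lemma simple_function_prod:
  fixes f :: "'i \<Rightarrow> 'a \<Rightarrow> real"
  assumes "finite I" "\<And>i. i \<in> I \<Longrightarrow> simple_function M (f i)"
  shows "simple_function M (\<lambda>\<omega>. \<Prod>i\<in>I. f i \<omega>)"
  using assms by (induction I rule: finite_induct) simp_all

lemma prod_of_bool:
  assumes "finite I"
  shows "(\<Prod>i\<in>I. of_bool (P i) :: real) = of_bool (\<forall>i\<in>I. P i)"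
  using assms by (induction I rule: finite_induct) auto

locale fd_design = fd_panel +
  assumes independent_groups: "indep_vars
          (\<lambda>_. Pi\<^sub>M {1..T} (\<lambda>_. borel \<Otimes>\<^sub>M borel \<Otimes>\<^sub>M borel)) (group_vector T N D Y) {1..G}"
    and strong_exogeneity: "\<And>g t. g \<in> {1..G} \<Longrightarrow> t \<in> {2..T} \<Longrightarrow>
          AE \<omega> in M. real_cond_exp M (treat_algebra M T N D g) (first_diff (pot_avg N Y 0) g t) \<omega>
            = (\<integral>\<omega>'. first_diff (pot_avg N Y 0) g t \<omega>' \<partial>M)"
    and common_trends: "\<And>t g g'. t \<in> {2..T} \<Longrightarrow> g \<in> {1..G} \<Longrightarrow> g' \<in> {1..G} \<Longrightarrow>
          (\<integral>\<omega>. first_diff (pot_avg N Y 0) g t \<omega> \<partial>M) = (\<integral>\<omega>. first_diff (pot_avg N Y 0) g' t \<omega> \<partial>M)"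
begin

abbreviation "trend g t \<equiv> first_diff (pot_avg N Y 0) g t"

lemma trend_integrable:
  assumes "g \<in> {1..G}" "t \<in> {2..T}"
  shows "integrable M (trend g t)"
  using assms by (intro first_diff_integrable pot_avg_integrable) simp_all

lemma treat_path_measurable:
  assumes "g \<in> {1..G}"
  shows "(\<lambda>\<omega>. \<lambda>t\<in>{1..T}. treat \<omega> g t) \<in> measurable M (Pi\<^sub>M {1..T} (\<lambda>_. borel))"
  by (intro measurable_restrict borel_measurable_simple_function treat_simple assms)

lemma subalgebra_treat_algebra:
  assumes "g \<in> {1..G}"
  shows "subalgebra M (treat_algebra M T N D g)"
  unfolding subalgebra_def treat_algebra_def
  by (intro conjI space_vimage_algebra sets_image_in_sets refl treat_path_measurable assms)

text \<open>The preimage of a measurable set of paths under the generating vector, so the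
  conditional expectation can be integrated over it.\<close>

lemma treat_path_event:
  "{\<omega> \<in> space M. \<forall>s\<in>{1..T}. treat \<omega> g s = p s} \<in> sets (treat_algebra M T N D g)"
proof -
  let ?A = "{v \<in> space (Pi\<^sub>M {1..T} (\<lambda>_. borel :: real measure)). \<forall>s\<in>{1..T}. v s = p s}"
  let ?R = "\<lambda>\<omega>. \<lambda>t\<in>{1..T}. treat \<omega> g t"
  have "?A \<in> sets (Pi\<^sub>M {1..T} (\<lambda>_. borel))"
    by measurable
  then have "?R -` ?A \<inter> space M \<in> sets (treat_algebra M T N D g)"
    unfolding treat_algebra_def by (rule in_vimage_algebra)
  moreover have "?R -` ?A \<inter> space M = {\<omega> \<in> space M. \<forall>s\<in>{1..T}. treat \<omega> g s = p s}"
    by (auto simp: space_PiM simp del: One_nat_def)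
  ultimately show ?thesis
    by (simp only:)
qed

text \<open>Integrating the conditional expectation over a path event turns exogeneity into an
  unconditional identity. Paths of probability 0 are covered, as nothing is divided by the
  probability.\<close>

lemma expectation_trend_on_path:
  assumes g: "g \<in> {1..G}" and t: "t \<in> {2..T}"
  shows "(\<integral>\<omega>. (trend g t \<omega> - expectation (trend g t)) * (\<Prod>s\<in>{1..T}. of_bool (treat \<omega> g s = p s)) \<partial>M) = 0"
proof -
  let ?F = "treat_algebra M T N D g" and ?\<mu> = "expectation (trend g t)"
  define E where "E = {\<omega> \<in> space M. \<forall>s\<in>{1..T}. treat \<omega> g s = p s}"
  interpret F: finite_measure_subalgebra M ?F
    using subalgebra_treat_algebra[OF g] by unfold_locales
  have EF: "E \<in> sets ?F"
    unfolding E_def by (rule treat_path_event)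
  then have E: "E \<in> sets M"
    using subalgebra_treat_algebra[OF g] by (auto simp: subalgebra_def)
  note int = trend_integrable[OF g t]
  have "(LINT \<omega>:E|M. trend g t \<omega>) = (LINT \<omega>:E|M. real_cond_exp M ?F (trend g t) \<omega>)"
    by (rule F.real_cond_exp_intA[OF int EF])
  also have "\<dots> = (LINT \<omega>:E|M. ?\<mu>)"
    using strong_exogeneity[OF g t] E
    by (intro set_lebesgue_integral_cong_AE) (auto intro: measurable_from_subalg[OF subalgebra_treat_algebra[OF g]])
  finally have eq: "(LINT \<omega>:E|M. trend g t \<omega>) = (LINT \<omega>:E|M. ?\<mu>)" .
  have "(\<integral>\<omega>. (trend g t \<omega> - ?\<mu>) * (\<Prod>s\<in>{1..T}. of_bool (treat \<omega> g s = p s)) \<partial>M)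
      = (LINT \<omega>:E|M. trend g t \<omega> - ?\<mu>)"
    unfolding set_lebesgue_integral_def
    by (intro Bochner_Integration.integral_cong refl)
      (simp add: prod_of_bool E_def indicator_def del: One_nat_def)
  also have "\<dots> = (LINT \<omega>:E|M. trend g t \<omega>) - (LINT \<omega>:E|M. ?\<mu>)"
    using integrable_mult_indicator[OF E int] integrable_mult_indicator[OF E, of "\<lambda>_. ?\<mu>"]
    by (intro set_integral_diff) (auto simp: set_integrable_def)
  finally show ?thesis
    by (simp add: eq)
qed

text \<open>On a fixed treatment pattern, the groups contribute independent factors, and exogeneity
  makes the factor of group \<open>g\<close> vanish.\<close>

lemma expectation_trend_on_pattern:
  fixes p :: "nat \<Rightarrow> nat \<Rightarrow> real" and g t :: nat
  assumes g: "g \<in> {1..G}" and t: "t \<in> {2..T}"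
  defines "V \<equiv> \<lambda>\<omega>. (trend g t \<omega> - expectation (trend g t))
    * (\<Prod>h\<in>{1..G}. \<Prod>s\<in>{1..T}. of_bool (treat \<omega> h s = p h s))"
  shows "integrable M V" and "expectation V = 0"
proof -
  let ?\<mu> = "expectation (trend g t)"
  \<comment> \<open>\<open>X h\<close> collects the factors of \<open>V\<close> from group
    \<open>h\<close>, the centred trend going to group \<open>g\<close>. \<open>\<phi> h\<close>
    writes it as a function of the vector of group \<open>h\<close>, so independence
    transfers.\<close>
  define X where "X h \<omega> = (if h = g then trend g t \<omega> - ?\<mu> else 1)
    * (\<Prod>s\<in>{1..T}. of_bool (treat \<omega> h s = p h s))" for h \<omega>
  define \<phi> :: "nat \<Rightarrow> (nat \<Rightarrow> real \<times> real \<times> real) \<Rightarrow> real" where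
    "\<phi> h v = (if h = g then fst (v t) - fst (v (t - 1)) - ?\<mu> else 1)
      * (\<Prod>s\<in>{1..T}. of_bool (snd (snd (v s)) = p h s))" for h v
  have VX: "V = (\<lambda>\<omega>. \<Prod>h\<in>{1..G}. X h \<omega>)"
    using g by (simp add: V_def X_def prod.distrib prod.delta' del: One_nat_def)
  have X_int: "integrable M (X h)" if h: "h \<in> {1..G}" for h
  proof -
    have "simple_function M (\<lambda>\<omega>. \<Prod>s\<in>{1..T}. of_bool (treat \<omega> h s = p h s) :: real)"
      by (intro simple_function_prod finite_atLeastAtMost simple_function_compose1[OF treat_simple] h)
    moreover have "integrable M (\<lambda>\<omega>. if h = g then trend g t \<omega> - ?\<mu> else 1)"
      using trend_integrable[OF g t] by (cases "h = g") simp_all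
    ultimately show ?thesis
      unfolding X_def by (subst mult.commute) (rule integrable_simple_function_mult)
  qed
  have comp: "(\<lambda>v. v s) \<in> measurable (Pi\<^sub>M {1..T} (\<lambda>_. borel \<Otimes>\<^sub>M borel \<Otimes>\<^sub>M borel))
      (borel \<Otimes>\<^sub>M borel \<Otimes>\<^sub>M (borel :: real measure) :: (real \<times> real \<times> real) measure)"
    if "s \<in> {1..T}" for s
    using that by (rule measurable_component_singleton)
  have fst_comp: "(\<lambda>v. fst (v s))
      \<in> borel_measurable (Pi\<^sub>M {1..T} (\<lambda>_. borel \<Otimes>\<^sub>M borel \<Otimes>\<^sub>M borel :: (real \<times> real \<times> real) measure))"
    if "s \<in> {1..T}" for s
    by (rule measurable_compose[OF comp[OF that] measurable_fst])
  have "\<phi> h \<in> borel_measurable (Pi\<^sub>M {1..T} (\<lambda>_. borel \<Otimes>\<^sub>M borel \<Otimes>\<^sub>M borel))" for h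
  proof -
    have "(\<lambda>v :: nat \<Rightarrow> real \<times> real \<times> real. if h = g then fst (v t) - fst (v (t - 1)) - ?\<mu> else 1)
        \<in> borel_measurable (Pi\<^sub>M {1..T} (\<lambda>_. borel \<Otimes>\<^sub>M borel \<Otimes>\<^sub>M borel))"
    proof (cases "h = g")
      case True
      show ?thesis
        unfolding if_P[OF True]
        by (intro borel_measurable_diff borel_measurable_const
            fst_comp[OF later_period[OF t]] fst_comp[OF previous_period[OF t]])
    qed simp
    moreover
    have "(\<lambda>v :: nat \<Rightarrow> real \<times> real \<times> real. of_bool (snd (snd (v s)) = p h s) :: real)
        \<in> borel_measurable (Pi\<^sub>M {1..T} (\<lambda>_. borel \<Otimes>\<^sub>M borel \<Otimes>\<^sub>M borel))" if "s \<in> {1..T}" for s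
    proof -
      have "(\<lambda>y :: real \<times> real \<times> real. indicator {p h s} (snd (snd y)) :: real)
          \<in> borel_measurable (borel \<Otimes>\<^sub>M borel \<Otimes>\<^sub>M borel)"
        by measurable
      from measurable_compose[OF comp[OF that] this] show ?thesis
        by (simp only: indicator_def singleton_iff)
    qed
    then have "(\<lambda>v :: nat \<Rightarrow> real \<times> real \<times> real. \<Prod>s\<in>{1..T}. of_bool (snd (snd (v s)) = p h s) :: real)
        \<in> borel_measurable (Pi\<^sub>M {1..T} (\<lambda>_. borel \<Otimes>\<^sub>M borel \<Otimes>\<^sub>M borel))"
      by (rule borel_measurable_prod)
    ultimately show ?thesis
      unfolding \<phi>_def by (rule borel_measurable_times)
  qed
  then have "indep_vars (\<lambda>_. borel) (\<lambda>h \<omega>. \<phi> h (group_vector T N D Y h \<omega>)) {1..G}"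
    by (intro indep_vars_compose2[OF independent_groups])
  moreover have "\<phi> h (group_vector T N D Y h \<omega>) = X h \<omega>" for h \<omega>
    using later_period[OF t] previous_period[OF t]
    by (simp add: \<phi>_def X_def group_vector_def first_diff_def del: One_nat_def)
  ultimately have indep: "indep_vars (\<lambda>_. borel) X {1..G}"
    by (simp only: eta_contract_eq)
  show "integrable M V"
    unfolding VX by (rule indep_vars_integrable[OF finite_atLeastAtMost indep X_int])
  have "expectation (X g) = 0"
    using expectation_trend_on_path[OF g t, of "p g"]
    by (simp add: X_def[abs_def] del: One_nat_def)
  then have X0: "(\<Prod>h\<in>{1..G}. expectation (X h)) = 0"
    using g by (intro prod_zero) auto
  have "expectation V = (\<Prod>h\<in>{1..G}. expectation (X h))"
    unfolding VX by (rule indep_vars_lebesgue_integral[OF finite_atLeastAtMost indep X_int])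
  then show "expectation V = 0"
    by (simp only: X0)
qed

text \<open>The weight involves the treatments of all groups, while exogeneity conditions on the own
  group only. Expanding the weight over the finitely many joint patterns bridges this gap.\<close>

lemma expectation_coef_trend:
  assumes g: "g \<in> {1..G}" and t: "t \<in> {2..T}"
  shows "(\<integral>\<omega>. coef \<omega> g t * trend g t \<omega> \<partial>M) = (\<integral>\<omega>. coef \<omega> g t \<partial>M) * expectation (trend g t)"
proof -
  let ?\<mu> = "expectation (trend g t)"
  \<comment> \<open>Restriction to the panel makes the range finite and lets equality of patterns
    mean agreement on the panel.\<close>
  define R where "R \<omega> = (\<lambda>h\<in>{1..G}. \<lambda>s\<in>{1..T}. treat \<omega> h s)" for \<omega>
  define B where "B p \<omega> = (\<Prod>h\<in>{1..G}. \<Prod>s\<in>{1..T}. of_bool (treat \<omega> h s = p h s) :: real)" for p \<omega>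
  have fin: "finite (R ` space M)"
  proof (rule finite_subset)
    show "R ` space M \<subseteq> (\<Pi>\<^sub>E h\<in>{1..G}. \<Pi>\<^sub>E s\<in>{1..T}. (\<lambda>\<omega>. treat \<omega> h s) ` space M)"
      unfolding R_def by (intro image_subsetI restrict_PiE_iff[THEN iffD2] ballI imageI)
    show "finite (\<Pi>\<^sub>E h\<in>{1..G}. \<Pi>\<^sub>E s\<in>{1..T}. (\<lambda>\<omega>. treat \<omega> h s) ` space M)"
      by (intro finite_PiE finite_atLeastAtMost simple_functionD(1)[OF treat_simple])
  qed
  have B: "B p \<omega> = of_bool (p = R \<omega>)" if "p \<in> R ` space M" for p \<omega>
  proof -
    have "B p \<omega> = of_bool (\<forall>h\<in>{1..G}. \<forall>s\<in>{1..T}. treat \<omega> h s = p h s)"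
      unfolding B_def by (simp only: prod_of_bool finite_atLeastAtMost)
    also have "(\<forall>h\<in>{1..G}. \<forall>s\<in>{1..T}. treat \<omega> h s = p h s) \<longleftrightarrow> p = R \<omega>"
      using that by (auto simp: R_def restrict_def fun_eq_iff simp del: One_nat_def)
    finally show ?thesis .
  qed
  have coef: "coef \<omega> g t = (\<Sum>p\<in>R ` space M. fd_coef G T N p g t * B p \<omega>)"
    if "\<omega> \<in> space M" for \<omega>
  proof -
    \<comment> \<open>Only the realised pattern \<open>R \<omega>\<close> has indicator 1 at
      \<open>\<omega>\<close>.\<close>
    have "(\<Sum>p\<in>R ` space M. fd_coef G T N p g t * B p \<omega>) = fd_coef G T N (R \<omega>) g t"
      using fin that by (simp add: B of_bool_def if_distrib sum.delta cong: if_cong sum.cong)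
    also have "\<dots> = coef \<omega> g t"
      using g t by (intro fd_coef_cong) (simp_all add: R_def)
    finally show ?thesis ..
  qed
  note pat = expectation_trend_on_pattern[OF g t]
  have "(\<integral>\<omega>. coef \<omega> g t * (trend g t \<omega> - ?\<mu>) \<partial>M)
      = (\<integral>\<omega>. (\<Sum>p\<in>R ` space M. fd_coef G T N p g t * ((trend g t \<omega> - ?\<mu>) * B p \<omega>)) \<partial>M)"
    by (intro Bochner_Integration.integral_cong refl)
      (simp only: coef sum_distrib_right mult.assoc mult.commute[of "B _ _"])
  also have "\<dots> = (\<Sum>p\<in>R ` space M. fd_coef G T N p g t * (\<integral>\<omega>. (trend g t \<omega> - ?\<mu>) * B p \<omega> \<partial>M))"
    unfolding B_def
    by (simp only: Bochner_Integration.integral_sum integrable_mult_right pat(1) integral_mult_right_zero)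
  also have "\<dots> = 0"
    unfolding B_def by (simp only: pat(2) mult_zero_right sum.neutral_const)
  finally have zero: "(\<integral>\<omega>. coef \<omega> g t * (trend g t \<omega> - ?\<mu>) \<partial>M) = 0" .
  have "integrable M (\<lambda>\<omega>. coef \<omega> g t * trend g t \<omega>)" "integrable M (\<lambda>\<omega>. coef \<omega> g t * ?\<mu>)"
    using g t by (intro integrable_simple_function_mult coef_simple trend_integrable; simp)+
  then have "(\<integral>\<omega>. coef \<omega> g t * (trend g t \<omega> - ?\<mu>) \<partial>M)
      = (\<integral>\<omega>. coef \<omega> g t * trend g t \<omega> \<partial>M) - (\<integral>\<omega>. coef \<omega> g t \<partial>M) * ?\<mu>"
    by (simp add: right_diff_distrib)
  with zero show ?thesis by simp
qed

text \<open>Once the mean trend no longer depends on the group, it factors out of each period, and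
  the weights cancel inside the expectation.\<close>

lemma expectation_sum_coef_trend:
  "(\<integral>\<omega>. (\<Sum>g\<in>{1..G}. \<Sum>t\<in>{2..T}. coef \<omega> g t * trend g t \<omega>) \<partial>M) = 0"
proof -
  have int_coef: "integrable M (\<lambda>\<omega>. coef \<omega> g t)" if "g \<in> {1..G}" "t \<in> {2..T}" for g t
    using integrable_simple_function_mult[OF coef_simple[OF that], of "\<lambda>_. 1"] by simp
  have "(\<integral>\<omega>. (\<Sum>g\<in>{1..G}. \<Sum>t\<in>{2..T}. coef \<omega> g t * trend g t \<omega>) \<partial>M)
      = (\<Sum>g\<in>{1..G}. \<Sum>t\<in>{2..T}. (\<integral>\<omega>. coef \<omega> g t * trend g t \<omega> \<partial>M))"
    by (simp only: Bochner_Integration.integral_sum Bochner_Integration.integrable_sum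
        integrable_simple_function_mult coef_simple trend_integrable cong: sum.cong)
  also have "\<dots> = (\<Sum>g\<in>{1..G}. \<Sum>t\<in>{2..T}. (\<integral>\<omega>. coef \<omega> g t \<partial>M) * expectation (trend 1 t))"
  proof (intro sum.cong refl)
    fix g t assume gt: "g \<in> {1..G}" "t \<in> {2..T}"
    \<comment> \<open>Group 1 is the reference for the common trend; it exists because the group
      \<open>g\<close> does.\<close>
    then have "1 \<in> {1..G}" by simp
    then show "(\<integral>\<omega>. coef \<omega> g t * trend g t \<omega> \<partial>M) = (\<integral>\<omega>. coef \<omega> g t \<partial>M) * expectation (trend 1 t)"
      by (simp only: expectation_coef_trend[OF gt] common_trends[OF gt(2,1)])
  qed
  also have "\<dots> = (\<Sum>t\<in>{2..T}. (\<Sum>g\<in>{1..G}. \<integral>\<omega>. coef \<omega> g t \<partial>M) * expectation (trend 1 t))"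
    by (subst sum.swap) (simp only: sum_distrib_right)
  also have "\<dots> = (\<Sum>t\<in>{2..T}. (\<integral>\<omega>. (\<Sum>g\<in>{1..G}. coef \<omega> g t) \<partial>M) * expectation (trend 1 t))"
    by (simp only: Bochner_Integration.integral_sum int_coef cong: sum.cong)
  also have "\<dots> = 0"
    by (intro sum.neutral ballI) (simp only: sum_coef_eq_0 integral_zero mult_zero_left)
  finally show ?thesis .
qed

end

section \<open>From the pathwise decomposition to expectations\<close>

theorem theorem2:
  fixes M :: "'a measure"
    and G T :: nat
    and N :: "nat \<Rightarrow> nat \<Rightarrow> nat"
    and D :: "nat \<Rightarrow> nat \<Rightarrow> nat \<Rightarrow> 'a \<Rightarrow> nat"
    and Y :: "nat \<Rightarrow> nat \<Rightarrow> nat \<Rightarrow> nat \<Rightarrow> 'a \<Rightarrow> real"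
  assumes prob: "prob_space M"
    and T: "2 \<le> T"
    and binary_treatment: "\<And>g t i. g \<in> {1..G} \<Longrightarrow> t \<in> {1..T} \<Longrightarrow> i \<in> {1..N g t} \<Longrightarrow>
          D i g t \<in> measurable M (count_space {0, 1})"
    and potential_outcomes: "\<And>d g t i. d \<in> {0, 1} \<Longrightarrow> g \<in> {1..G} \<Longrightarrow> t \<in> {1..T} \<Longrightarrow>
          i \<in> {1..N g t} \<Longrightarrow> integrable M (Y d i g t)"
    and not_collinear: "AE \<omega> in M.
          \<not> fe_collinear G T (\<lambda>g t. first_diff (treat_avg N D) g t \<omega>)"
    and balanced_panel: "\<And>g t. g \<in> {1..G} \<Longrightarrow> t \<in> {1..T} \<Longrightarrow> 0 < N g t"
    and sharp_design: "\<And>g t i. g \<in> {1..G} \<Longrightarrow> t \<in> {1..T} \<Longrightarrow> i \<in> {1..N g t} \<Longrightarrow>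
          AE \<omega> in M. real (D i g t \<omega>) = treat_avg N D g t \<omega>"
    and independent_groups: "prob_space.indep_vars M
          (\<lambda>_. Pi\<^sub>M {1..T} (\<lambda>_. borel \<Otimes>\<^sub>M borel \<Otimes>\<^sub>M borel)) (group_vector T N D Y) {1..G}"
    and strong_exogeneity: "\<And>g t. g \<in> {1..G} \<Longrightarrow> t \<in> {2..T} \<Longrightarrow>
          AE \<omega> in M. real_cond_exp M (treat_algebra M T N D g) (first_diff (pot_avg N Y 0) g t) \<omega>
            = (\<integral>\<omega>'. first_diff (pot_avg N Y 0) g t \<omega>' \<partial>M)"
    and common_trends: "\<And>t g g'. t \<in> {2..T} \<Longrightarrow> g \<in> {1..G} \<Longrightarrow> g' \<in> {1..G} \<Longrightarrow>
          (\<integral>\<omega>. first_diff (pot_avg N Y 0) g t \<omega> \<partial>M) = (\<integral>\<omega>. first_diff (pot_avg N Y 0) g' t \<omega> \<partial>M)"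
  shows "integrable M (beta_fd_hat G T N D Y) \<and>
         integrable M (weighted_effects_fd G T N D Y) \<and>
         beta_fd M G T N D Y = (\<integral>\<omega>. weighted_effects_fd G T N D Y \<omega> \<partial>M)"
proof -
  interpret prob_space M by (rule prob)
  interpret fd_design M G T N D Y
    by unfold_locales (fact T binary_treatment potential_outcomes balanced_panel independent_groups
        strong_exogeneity common_trends)+
  \<comment> \<open>Finitely many almost sure equalities share one null set, as the pathwise
    decomposition requires all of them at once.\<close>
  have sharp: "AE \<omega> in M. \<forall>g\<in>{1..G}. \<forall>t\<in>{1..T}. \<forall>i\<in>{1..N g t}. real (D i g t \<omega>) = treat_avg N D g t \<omega>"
    by (intro AE_finite_allI finite_atLeastAtMost sharp_design)
  have "AE \<omega> in M. beta_fd_hat G T N D Y \<omega> = weighted_effects_fd G T N D Y \<omega>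
      + (\<Sum>g\<in>{1..G}. \<Sum>t\<in>{2..T}. coef \<omega> g t * trend g t \<omega>)"
    using not_collinear sharp AE_space
  proof eventually_elim
    case (elim \<omega>)
    show ?case
      by (rule beta_fd_hat_decomp[OF elim(1) treatment_binary[OF _ _ _ elim(3)] elim(2)[rule_format]])
  qed
  moreover have int: "integrable M (\<lambda>\<omega>. \<Sum>g\<in>{1..G}. \<Sum>t\<in>{2..T}. coef \<omega> g t * trend g t \<omega>)"
    by (intro Bochner_Integration.integrable_sum integrable_simple_function_mult coef_simple
        trend_integrable)
  ultimately have "expectation (beta_fd_hat G T N D Y)
      = (\<integral>\<omega>. weighted_effects_fd G T N D Y \<omega>
          + (\<Sum>g\<in>{1..G}. \<Sum>t\<in>{2..T}. coef \<omega> g t * trend g t \<omega>) \<partial>M)"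
    using beta_fd_hat_integrable weighted_effects_fd_integrable
    by (intro integral_cong_AE borel_measurable_integrable Bochner_Integration.integrable_add)
  also have "\<dots> = expectation (weighted_effects_fd G T N D Y)"
    by (simp only: Bochner_Integration.integral_add[OF weighted_effects_fd_integrable int]
        expectation_sum_coef_trend add_0_right)
  finally show ?thesis
    using beta_fd_hat_integrable weighted_effects_fd_integrable by (simp only: beta_fd_def simp_thms)
qed

end
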